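(* Let $n\ge k\ge 0$ be integers, let $a,b,c,d$ be real numbers, put $t=a+b+c+d$ and $P=P_{n,k}^{(a,b,c,d)}$. Then, with the 24 operators $\mathcal M_{0,s},\mathcal M_{0,s}^\dagger,\mathcal M_{s,0},\mathcal M_{s,0}^\dagger$ ($1\le s\le 6$) given in the context (for the parameters $n,k,a,b,c,d$), the following 24 identities hold at all real $(x,y)$ with $x\neq 1$. First set: $$\begin{aligned} \mathcal M_{0,1}P&=(k+b+c+1)P_{n-1,k-1}^{(a,b+1,c+1,d)}, & \mathcal M_{0,1}^\dagger P&=(k+1)P_{n+1,k+1}^{(a,b-1,c-1,d)},\\ \mathcal M_{0,2}P&=(k+b+c+1)P_{n,k}^{(a,b,c+1,d-1)}, & \mathcal M_{0,2}^\dagger P&=(k+c)P_{n,k}^{(a,b,c-1,d+1)},\\ \mathcal M_{0,3}P&=(k+b+c+1)P_{n,k}^{(a,b+1,c,d-1)}, & \mathcal M_{0,3}^\dagger P&=(k+b)P_{n,k}^{(a,b-1,c,d+1)},\\ \mathcal M_{0,4}P&=(k+1)P_{n+1,k+1}^{(a,b,c-1,d-1)}, & \mathcal M_{0,4}^\dagger P&=(k+b)P_{n-1,k-1}^{(a,b,c+1,d+1)},\\ \mathcal M_{0,5}P&=(k+1)P_{n+1,k+1}^{(a,b-1,c,d-1)}, & \mathcal M_{0,5}^\dagger P&=(k+c)P_{n-1,k-1}^{(a,b+1,c,d+1)},\\ \mathcal M_{0,6}P&=(k+c)P_{n,k}^{(a,b+1,c-1,d)}, & \mathcal M_{0,6}^\dagger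 P&=(k+b)P_{n,k}^{(a,b-1,c+1,d)}. \end{aligned}$$ Second set: $$\begin{aligned} \mathcal M_{1,0}P&=(n+k+t+2)P_{n-1,k}^{(a+1,b,c,d+1)}, & \mathcal M_{1,0}^\dagger P&=(n-k+1)P_{n+1,k}^{(a-1,b,c,d-1)},\\ \mathcal M_{2,0}P&=(n+k+t+2)P_{n,k}^{(a,b,c,d+1)}, & \mathcal M_{2,0}^\dagger P&=(n+k+t-a+1)P_{n,k}^{(a,b,c,d-1)},\\ \mathcal M_{3,0}P&=(n+k+t+2)P_{n,k}^{(a+1,b,c,d)}, & \mathcal M_{3,0}^\dagger P&=(n-k+a)P_{n,k}^{(a-1,b,c,d)},\\ \mathcal M_{4,0}P&=(n-k+1)P_{n+1,k}^{(a,b,c,d-1)}, & \mathcal M_{4,0}^\dagger P&=(n-k+a)P_{n-1,k}^{(a,b,c,d+1)},\\ \mathcal M_{5,0}P&=(n+k+t-a+1)P_{n-1,k}^{(a+1,b,c,d)}, & \mathcal M_{5,0}^\dagger P&=(n-k+1)P_{n+1,k}^{(a-1,b,c,d)},\\ \mathcal M_{6,0}P&=(n-k+a)P_{n,k}^{(a-1,b,c,d+1)}, & \mathcal M_{6,0}^\dagger P&=(n+k+t-a+1)P_{n,k}^{(a+1,b,c,d-1)}. \end{aligned}$$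
   Context: Jacobi polynomials: for an integer $m\ge 0$ and real $\alpha,\beta$, $P_m^{(\alpha,\beta)}(x)=\sum_{s=0}^m\binom{m+\alpha}{m-s}\binom{m+\beta}{s}\left(\frac{x-1}{2}\right)^s\left(\frac{x+1}{2}\right)^{m-s}$ (generalized binomial coefficients), and $P_{-1}^{(\alpha,\beta)}=0$. Shifted Jacobi polynomials: $\tilde P_m^{(\alpha,\beta)}(x)=P_m^{(\alpha,\beta)}(2x-1)$. For real $a,b,c,d$ and integers $n,k$, at points with $x\ne1$, $$P_{n,k}^{(a,b,c,d)}(x,y)=\tilde P_{n-k}^{(2k+b+c+d+1,a)}(x)\,(1-x)^k\,\tilde P_k^{(c,b)}\!\left(\tfrac{y}{1-x}\right)\qquad (n\ge k\ge 0),$$ and $P_{n,k}^{(a,b,c,d)}=0$ whenever $k=-1$ or $n-k=-1$. Write $z=1-x-y$, $u_x=\partial u/\partial x$, $u_y=\partial u/\partial y$. The ladder operators (depending on $n,k,a,b,c,d$) acting on a function $u(x,y)$ are as follows. First set: $\mathcal M_{0,1}u=u_y$; $\mathcal M_{0,1}^\dagger u=(yc-zb)u-yz\,u_y$; $\mathcal M_{0,2}u=(k+b+c+1)u+y\,u_y$; $\mathcal M_{0,2}^\dagger u=\left(c+k-\frac{yk}{1-x}\right)u-\frac{yz}{1-x}u_y$; $\mathcal M_{0,3}u=(k+b+c+1)u-z\,u_y$; $\mathcal M_{0,3}^\dagger u=\left(b+\frac{ky}{1-x}\right)u+\frac{yz}{1-x}u_y$; $\mathcal M_{0,4}u=(yc-z(b+k+1))u-yz\,u_y$;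 $\mathcal M_{0,4}^\dagger u=-\frac{k}{1-x}u+\frac{y}{1-x}u_y$; $\mathcal M_{0,5}u=(y(c+k+1)-zb)u-yz\,u_y$; $\mathcal M_{0,5}^\dagger u=\frac{k}{1-x}u+\left(1-\frac{y}{1-x}\right)u_y$; $\mathcal M_{0,6}u=cu-z\,u_y$; $\mathcal M_{0,6}^\dagger u=bu+y\,u_y$. Second set: $\mathcal M_{1,0}u=\frac{k}{1-x}u+u_x-\frac{y}{1-x}u_y$; $\mathcal M_{1,0}^\dagger u=(x(k+a+b+c+d+1)-a)u-x(1-x)u_x+xy\,u_y$; $\mathcal M_{2,0}u=(n+k+a+b+c+d+2)u+\frac{xk}{1-x}u+x\,u_x-\frac{xy}{1-x}u_y$; $\mathcal M_{2,0}^\dagger u=(n+k+b+c+d+1-xn)u-x(1-x)u_x+xy\,u_y$; $\mathcal M_{3,0}u=(n+a+b+c+d+2)u-(1-x)u_x+y\,u_y$; $\mathcal M_{3,0}^\dagger u=(a+xn)u+x(1-x)u_x-xy\,u_y$; $\mathcal M_{4,0}u=(x(n+a+b+c+d+2)-a-n+k-1)u-x(1-x)u_x+xy\,u_y$; $\mathcal M_{4,0}^\dagger u=\frac{k}{1-x}u-nu+x\,u_x-\frac{xy}{1-x}u_y$; $\mathcal M_{5,0}u=nu+(1-x)u_x-y\,u_y$; $\mathcal M_{5,0}^\dagger u=x(n+a+b+c+d+2)u-au-x(1-x)u_x+xy\,u_y$; $\mathcal M_{6,0}u=au+\frac{xk}{1-x}u+x\,u_x-\frac{xy}{1-x}u_y$;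 $\mathcal M_{6,0}^\dagger u=(k+b+c+d+1)u-(1-x)u_x+y\,u_y$. *)

theory Defs
  imports "HOL-Analysis.Analysis"
begin

(* The degree is an integer so that the convention P_{-1} = 0 can be stated.
   gchoose is the generalized binomial coefficient. *)
definition jacobi :: "int \<Rightarrow> real \<Rightarrow> real \<Rightarrow> real \<Rightarrow> real" where
  "jacobi m \<alpha> \<beta> x =
     (if m < 0 then 0
      else \<Sum>s = 0..nat m.
        ((real_of_int m + \<alpha>) gchoose (nat m - s)) * ((real_of_int m + \<beta>) gchoose s)
          * ((x - 1) / 2) ^ s * ((x + 1) / 2) ^ (nat m - s))"

definition shifted_jacobi :: "int \<Rightarrow> real \<Rightarrow> real \<Rightarrow> real \<Rightarrow> real" where
  "shifted_jacobi m \<alpha> \<beta> x = jacobi m \<alpha> \<beta> (2 * x - 1)"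

(* Meaningful only for x \<noteq> 1. The value 0 outside 0 \<le> k \<le> n covers the two
   conventional cases k = -1 and n - k = -1. *)
definition jacobi2 ::
    "int \<Rightarrow> int \<Rightarrow> real \<Rightarrow> real \<Rightarrow> real \<Rightarrow> real \<Rightarrow> real \<Rightarrow> real \<Rightarrow> real" where
  "jacobi2 n k a b c d x y =
     (if 0 \<le> k \<and> k \<le> n
      then shifted_jacobi (n - k) (2 * real_of_int k + b + c + d + 1) a x
             * (1 - x) ^ nat k * shifted_jacobi k c b (y / (1 - x))
      else 0)"

definition pdx :: "(real \<Rightarrow> real \<Rightarrow> real) \<Rightarrow> real \<Rightarrow> real \<Rightarrow> real" where
  "pdx u x y = deriv (\<lambda>s. u s y) x"

definition pdy :: "(real \<Rightarrow> real \<Rightarrow> real) \<Rightarrow> real \<Rightarrow> real \<Rightarrow> real" where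
  "pdy u x y = deriv (\<lambda>s. u x s) y"

(* Ladder operators: the arguments are n, k, a, b, c, d and the function acted on.
   All operators take the full parameter list, even where some parameters are unused.
   The quantity z = 1 - x - y is written out. *)
type_synonym ladder =
  "int \<Rightarrow> int \<Rightarrow> real \<Rightarrow> real \<Rightarrow> real \<Rightarrow> real \<Rightarrow> (real \<Rightarrow> real \<Rightarrow> real) \<Rightarrow> real \<Rightarrow> real \<Rightarrow> real"

definition M01 :: ladder where
  "M01 n k a b c d u x y = pdy u x y"

definition M01_dag :: ladder where
  "M01_dag n k a b c d u x y = (y * c - (1 - x - y) * b) * u x y - y * (1 - x - y) * pdy u x y"

definition M02 :: ladder where
  "M02 n k a b c d u x y = (k + b + c + 1) * u x y + y * pdy u x y"

definition M02_dag :: ladder where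
  "M02_dag n k a b c d u x y =
     (c + k - y * k / (1 - x)) * u x y - y * (1 - x - y) / (1 - x) * pdy u x y"

definition M03 :: ladder where
  "M03 n k a b c d u x y = (k + b + c + 1) * u x y - (1 - x - y) * pdy u x y"

definition M03_dag :: ladder where
  "M03_dag n k a b c d u x y =
     (b + k * y / (1 - x)) * u x y + y * (1 - x - y) / (1 - x) * pdy u x y"

definition M04 :: ladder where
  "M04 n k a b c d u x y =
     (y * c - (1 - x - y) * (b + k + 1)) * u x y - y * (1 - x - y) * pdy u x y"

definition M04_dag :: ladder where
  "M04_dag n k a b c d u x y = - (k / (1 - x)) * u x y + y / (1 - x) * pdy u x y"

definition M05 :: ladder where
  "M05 n k a b c d u x y =
     (y * (c + k + 1) - (1 - x - y) * b) * u x y - y * (1 - x - y) * pdy u x y"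

definition M05_dag :: ladder where
  "M05_dag n k a b c d u x y = k / (1 - x) * u x y + (1 - y / (1 - x)) * pdy u x y"

definition M06 :: ladder where
  "M06 n k a b c d u x y = c * u x y - (1 - x - y) * pdy u x y"

definition M06_dag :: ladder where
  "M06_dag n k a b c d u x y = b * u x y + y * pdy u x y"

definition M10 :: ladder where
  "M10 n k a b c d u x y = k / (1 - x) * u x y + pdx u x y - y / (1 - x) * pdy u x y"

definition M10_dag :: ladder where
  "M10_dag n k a b c d u x y =
     (x * (k + a + b + c + d + 1) - a) * u x y - x * (1 - x) * pdx u x y + x * y * pdy u x y"

definition M20 :: ladder where
  "M20 n k a b c d u x y =
     (n + k + a + b + c + d + 2) * u x y + x * k / (1 - x) * u x y + x * pdx u x y
       - x * y / (1 - x) * pdy u x y"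

definition M20_dag :: ladder where
  "M20_dag n k a b c d u x y =
     (n + k + b + c + d + 1 - x * n) * u x y - x * (1 - x) * pdx u x y + x * y * pdy u x y"

definition M30 :: ladder where
  "M30 n k a b c d u x y =
     (n + a + b + c + d + 2) * u x y - (1 - x) * pdx u x y + y * pdy u x y"

definition M30_dag :: ladder where
  "M30_dag n k a b c d u x y =
     (a + x * n) * u x y + x * (1 - x) * pdx u x y - x * y * pdy u x y"

definition M40 :: ladder where
  "M40 n k a b c d u x y =
     (x * (n + a + b + c + d + 2) - a - n + k - 1) * u x y - x * (1 - x) * pdx u x y
       + x * y * pdy u x y"

definition M40_dag :: ladder where
  "M40_dag n k a b c d u x y =
     k / (1 - x) * u x y - n * u x y + x * pdx u x y - x * y / (1 - x) * pdy u x y"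

definition M50 :: ladder where
  "M50 n k a b c d u x y = n * u x y + (1 - x) * pdx u x y - y * pdy u x y"

definition M50_dag :: ladder where
  "M50_dag n k a b c d u x y =
     x * (n + a + b + c + d + 2) * u x y - a * u x y - x * (1 - x) * pdx u x y
       + x * y * pdy u x y"

definition M60 :: ladder where
  "M60 n k a b c d u x y =
     a * u x y + x * k / (1 - x) * u x y + x * pdx u x y - x * y / (1 - x) * pdy u x y"

definition M60_dag :: ladder where
  "M60_dag n k a b c d u x y =
     (k + b + c + d + 1) * u x y - (1 - x) * pdx u x y + y * pdy u x y"


end

theory Submission
  imports Defs
begin

text \<open>
  With \<^term>\<open>v = w - 1\<close> the shifted Jacobi polynomial is a homogeneous form in \<^term>\<open>v\<close> and
  \<^term>\<open>w\<close> whose two partial derivatives are again multiples of shifted Jacobi polynomials. Euler's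
  identity for this form, the two Pascal rules and the sum of the two partial derivatives yield
  twelve ladder relations in one variable. Both sets of operators act on a product
  \<^term>\<open>F x * (1 - x) ^ k * G (y / (1 - x))\<close>: the first set acts by the twelve relations on
  \<^term>\<open>G\<close>, the second set by the same relations on \<^term>\<open>F\<close>, because
  \<^term>\<open>(1 - x) ^ k * G (y / (1 - x))\<close> is homogeneous of degree \<^term>\<open>k\<close> in \<^term>\<open>1 - x\<close>
  and \<^term>\<open>y\<close>.
\<close>

section \<open>Homogeneous forms with free upper binomial arguments\<close>

text \<open>The arguments \<open>X\<close> and \<open>Y\<close> stand for
  \<open>m + \<alpha>\<close> and \<open>m + \<beta>\<close> but are not tied to \<open>m\<close>: a
  derivative or a Pascal step lowers the degree and changes at most one of them. Independent
  \<open>v\<close> and \<open>w\<close> make the form homogeneous of degree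
  \<open>m\<close>.\<close>

definition jacobi_form :: "nat \<Rightarrow> real \<Rightarrow> real \<Rightarrow> real \<Rightarrow> real \<Rightarrow> real" where
  "jacobi_form m X Y v w = (\<Sum>s\<le>m. (X gchoose (m - s)) * (Y gchoose s) * v ^ s * w ^ (m - s))"

lemma jacobi_form_0 [simp]: "jacobi_form 0 X Y v w = 1"
  by (simp add: jacobi_form_def)

text \<open>Index reversal from \<open>s\<close> to \<open>m - s\<close>. It transfers the Pascal
  rule from \<open>X\<close> to \<open>Y\<close>.\<close>

lemma jacobi_form_swap: "jacobi_form m X Y v w = jacobi_form m Y X w v"
proof -
  have "jacobi_form m X Y v w =
      (\<Sum>s\<le>m. (X gchoose (m - (m - s))) * (Y gchoose (m - s)) * v ^ (m - s) * w ^ (m - (m - s)))"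
    unfolding jacobi_form_def by
    (rule sum.nat_diff_reindex [symmetric, of _ "Suc m", simplified lessThan_Suc_atMost diff_Suc_Suc])
  also have "\<dots> = jacobi_form m Y X w v"
    unfolding jacobi_form_def by (rule sum.cong) (auto simp: mult_ac)
  finally show ?thesis .
qed

text \<open>The left side is the termwise derivative in \<open>v\<close>. Its term
  \<open>s = 0\<close> vanishes, and absorption pulls the factor \<open>Y\<close> out of the others.
  As a sum it serves both Euler's identity and the derivative along
  \<open>v = w - 1\<close>.\<close>

lemma jacobi_form_partial_left:
  "(\<Sum>s\<le>Suc m. (X gchoose (Suc m - s)) * (Y gchoose s) * (real s * v ^ (s - 1)) * w ^ (Suc m - s))
    = Y * jacobi_form m X (Y - 1) v w"
proof -
  have "(\<Sum>s\<le>Suc m. (X gchoose (Suc m - s)) * (Y gchoose s) * (real s * v ^ (s - 1)) * w ^ (Suc m - s))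
      = (\<Sum>s\<le>m. (X gchoose (m - s)) * (real (Suc s) * (Y gchoose Suc s)) * v ^ s * w ^ (m - s))"
    by (subst sum.atMost_Suc_shift) (simp add: mult_ac)
  also have "\<dots> = (\<Sum>s\<le>m. Y * ((X gchoose (m - s)) * ((Y - 1) gchoose s) * v ^ s * w ^ (m - s)))"
    by (simp only: gbinomial_absorption mult_ac)
  finally show ?thesis
    by (simp add: jacobi_form_def sum_distrib_left)
qed

text \<open>The same for the derivative in \<open>w\<close>: here the term \<open>s = Suc m\<close>
  vanishes and absorption acts on \<open>X\<close>.\<close>

lemma jacobi_form_partial_right:
  "(\<Sum>s\<le>Suc m. (X gchoose (Suc m - s)) * (Y gchoose s) * v ^ s * (real (Suc m - s) * w ^ (Suc m - s - 1)))
    = X * jacobi_form m (X - 1) Y v w"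
proof -
  have "(\<Sum>s\<le>Suc m. (X gchoose (Suc m - s)) * (Y gchoose s) * v ^ s * (real (Suc m - s) * w ^ (Suc m - s - 1)))
      = (\<Sum>s\<le>m. (real (Suc (m - s)) * (X gchoose Suc (m - s))) * (Y gchoose s) * v ^ s * w ^ (m - s))"
    by (simp add: Suc_diff_le mult_ac del: of_nat_Suc of_nat_diff)
  also have "\<dots> = (\<Sum>s\<le>m. X * (((X - 1) gchoose (m - s)) * (Y gchoose s) * v ^ s * w ^ (m - s)))"
    by (simp only: gbinomial_absorption mult_ac)
  finally show ?thesis
    by (simp add: jacobi_form_def sum_distrib_left)
qed

text \<open>The term of index \<open>s\<close> has degree \<open>s\<close> in \<open>v\<close> and
  \<open>Suc m - s\<close> in \<open>w\<close>, and these add up to \<open>Suc m\<close>.\<close>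

lemma jacobi_form_euler:
  "real (Suc m) * jacobi_form (Suc m) X Y v w =
    v * (Y * jacobi_form m X (Y - 1) v w) + w * (X * jacobi_form m (X - 1) Y v w)"
proof -
  have "real (Suc m) * ((X gchoose (Suc m - s)) * (Y gchoose s) * v ^ s * w ^ (Suc m - s)) =
      v * ((X gchoose (Suc m - s)) * (Y gchoose s) * (real s * v ^ (s - 1)) * w ^ (Suc m - s)) +
      w * ((X gchoose (Suc m - s)) * (Y gchoose s) * v ^ s
             * (real (Suc m - s) * w ^ (Suc m - s - 1)))"
    if "s \<le> Suc m" for s
  proof -
    have "v * (real s * v ^ (s - 1)) = real s * v ^ s"
      by (cases s) auto
    moreover have "w * (real (Suc m - s) * w ^ (Suc m - s - 1)) = real (Suc m - s) * w ^ (Suc m - s)"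
      by (cases "Suc m - s") auto
    moreover have "real (Suc m) = real s + real (Suc m - s)"
      using that by linarith
    \<comment> \<open>Powers and binomials become free variables, so the truncated exponents
      \<open>s - 1\<close> and \<open>Suc m - s - 1\<close> disappear from the polynomial
      identity.\<close>
    moreover have "c = i + j \<Longrightarrow> v * i' = i * p \<Longrightarrow> w * j' = j * q \<Longrightarrow>
        c * (x * y * p * q) = v * (x * y * i' * q) + w * (x * y * p * j')"
      for c i j i' j' p q x y :: real by algebra
    ultimately show ?thesis by blast
  qed
  then show ?thesis
    unfolding jacobi_form_partial_left [symmetric] jacobi_form_partial_right [symmetric]
    by (simp add: jacobi_form_def sum_distrib_left sum.distrib [symmetric]
        del: sum.atMost_Suc of_nat_Suc)
qed

text \<open>Chain rule along \<open>v = w - 1\<close>: both inner derivatives are 1, so the two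
  partial derivatives simply add.\<close>

lemma jacobi_form_has_derivative:
  "((\<lambda>w. jacobi_form (Suc m) X Y (w - 1) w) has_real_derivative
    Y * jacobi_form m X (Y - 1) (w - 1) w + X * jacobi_form m (X - 1) Y (w - 1) w) (at w)"
  unfolding jacobi_form_partial_left [symmetric] jacobi_form_partial_right [symmetric]
    sum.distrib [symmetric] unfolding jacobi_form_def
  by (intro DERIV_sum) (auto intro!: derivative_eq_intros simp: algebra_simps)

lemma jacobi_form_pascal:
  "jacobi_form (Suc m) (X + 1) Y v w = jacobi_form (Suc m) X Y v w + w * jacobi_form m X Y v w"
proof -
  \<comment> \<open>Only the terms \<open>s \<le> m\<close> split by Pascal's rule. For
    \<open>s = Suc m\<close> the binomial in \<open>X\<close> has lower index 0, hence equals 1, and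
    this term is set apart.\<close>
  have "jacobi_form (Suc m) (X + 1) Y v w =
      (\<Sum>s\<le>m. ((X gchoose (m - s)) + (X gchoose Suc (m - s))) * (Y gchoose s) * v ^ s
              * w ^ Suc (m - s)) + (Y gchoose Suc m) * v ^ Suc m"
    by (simp add: jacobi_form_def Suc_diff_le gbinomial_Suc_Suc)
  also have "\<dots> = jacobi_form (Suc m) X Y v w + w * jacobi_form m X Y v w"
    by (simp add: jacobi_form_def Suc_diff_le distrib_left distrib_right sum.distrib sum_distrib_left mult_ac)
  finally show ?thesis .
qed

text \<open>Absorption gives the term of index \<open>s\<close> the weights \<open>Y + 1 - s\<close>
  and \<open>X + 1 - (m - s)\<close>. Their sum is independent of \<open>s\<close>, so the total
  derivative is a multiple of one form.\<close>

lemma jacobi_form_sum_partials: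
  "(Y + 1) * jacobi_form m (X + 1) Y v w + (X + 1) * jacobi_form m X (Y + 1) v w =
    (X + Y + 2 - real m) * jacobi_form m (X + 1) (Y + 1) v w"
proof -
  have absorb: "(Z + 1) * (Z gchoose i) = (Z + 1 - real i) * ((Z + 1) gchoose i)" for Z :: real and i
    using gbinomial_absorb_comp [of "Z + 1" i] by simp
  have "(Y + 1) * (((X + 1) gchoose (m - s)) * (Y gchoose s) * v ^ s * w ^ (m - s))
      + (X + 1) * ((X gchoose (m - s)) * ((Y + 1) gchoose s) * v ^ s * w ^ (m - s))
      = (X + Y + 2 - real m) * (((X + 1) gchoose (m - s)) * ((Y + 1) gchoose s) * v ^ s * w ^ (m - s))"
    if "s \<le> m" for s
  proof -
    have "real m = real s + real (m - s)" using that by simp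
    moreover have "c = i + j \<Longrightarrow> (Y + 1) * y = (Y + 1 - i) * y' \<Longrightarrow> (X + 1) * x = (X + 1 - j) * x' \<Longrightarrow>
        (Y + 1) * (x' * y * p * q) + (X + 1) * (x * y' * p * q) = (X + Y + 2 - c) * (x' * y' * p * q)"
      for c i j x y x' y' p q :: real by algebra
    ultimately show ?thesis using absorb by blast
  qed
  then show ?thesis
    by (simp add: jacobi_form_def sum_distrib_left sum.distrib [symmetric])
qed

section \<open>One-variable shifted Jacobi polynomials of integer degree\<close>

lemma shifted_jacobi_neg: "m < 0 \<Longrightarrow> shifted_jacobi m \<alpha> \<beta> w = 0"
  by (simp add: shifted_jacobi_def jacobi_def)

lemma shifted_jacobi_eq_form:
  "shifted_jacobi (int m) \<alpha> \<beta> w = jacobi_form m (real m + \<alpha>) (real m + \<beta>) (w - 1) w"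
proof -
  have "(2 * w - 1 - 1) / 2 = w - 1" "(2 * w - 1 + 1) / 2 = w" by (simp_all add: field_simps)
  then show ?thesis
    unfolding shifted_jacobi_def jacobi_def jacobi_form_def by (simp only: atLeast0AtMost) simp
qed

text \<open>In the first two cases the degree \<open>m - 1\<close> is negative and its polynomial is
  0 by convention; in the third it is \<open>int j\<close>, where the form identities apply.\<close>

lemma int_cases_Suc:
  fixes m :: int
  obtains "m < 0" | "m = 0" | j where "m = int (Suc j)"
proof -
  have "m < 0 \<or> m = 0 \<or> m = int (Suc (nat (m - 1)))" by auto
  then show thesis using that by blast
qed

text \<open>The form of lower degree keeps its upper arguments, and
  \<open>m + \<alpha> = (m - 1) + (\<alpha> + 1)\<close>, likewise for \<open>\<beta>\<close>; hence
  both parameters rise in the last term.\<close>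

lemma shifted_jacobi_pascal_left:
  "shifted_jacobi m (\<alpha> + 1) \<beta> w =
    shifted_jacobi m \<alpha> \<beta> w + w * shifted_jacobi (m - 1) (\<alpha> + 1) (\<beta> + 1) w"
proof (cases m rule: int_cases_Suc)
  case 2
  then show ?thesis
    using shifted_jacobi_eq_form [of 0] by (simp add: shifted_jacobi_neg)
next
  case (3 j)
  then show ?thesis
    using jacobi_form_pascal [of j "real (Suc j) + \<alpha>"]
    by (simp add: shifted_jacobi_eq_form add_ac del: of_nat_Suc)
       (simp add: shifted_jacobi_eq_form add_ac)
qed (simp add: shifted_jacobi_neg)

lemma shifted_jacobi_pascal_right:
  "shifted_jacobi m \<alpha> (\<beta> + 1) w =
    shifted_jacobi m \<alpha> \<beta> w + (w - 1) * shifted_jacobi (m - 1) (\<alpha> + 1) (\<beta> + 1) w"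
proof (cases m rule: int_cases_Suc)
  case 2
  then show ?thesis
    using shifted_jacobi_eq_form [of 0] by (simp add: shifted_jacobi_neg)
next
  case (3 j)
  then show ?thesis
    using jacobi_form_pascal [of j "real (Suc j) + \<beta>" "real (Suc j) + \<alpha>" w "w - 1"]
    by (simp add: shifted_jacobi_eq_form jacobi_form_swap [of _ _ _ w] add_ac del: of_nat_Suc)
       (simp add: shifted_jacobi_eq_form add_ac)
qed (simp add: shifted_jacobi_neg)

lemma shifted_jacobi_euler:
  "m * shifted_jacobi m \<alpha> \<beta> w =
    (w - 1) * ((m + \<beta>) * shifted_jacobi (m - 1) (\<alpha> + 1) \<beta> w)
    + w * ((m + \<alpha>) * shifted_jacobi (m - 1) \<alpha> (\<beta> + 1) w)"
proof (cases m rule: int_cases_Suc)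
  case (3 j)
  then have "m - 1 = int j" by simp
  with 3 show ?thesis
    using jacobi_form_euler [of j "real (Suc j) + \<alpha>" "real (Suc j) + \<beta>" "w - 1" w]
    by (simp only: shifted_jacobi_eq_form) (simp add: add_ac)
qed (simp_all add: shifted_jacobi_neg)

lemma shifted_jacobi_sum_partials:
  "(m + \<beta>) * shifted_jacobi (m - 1) (\<alpha> + 1) \<beta> w + (m + \<alpha>) * shifted_jacobi (m - 1) \<alpha> (\<beta> + 1) w
    = (m + \<alpha> + \<beta> + 1) * shifted_jacobi (m - 1) (\<alpha> + 1) (\<beta> + 1) w"
proof (cases m rule: int_cases_Suc)
  case (3 j)
  then have "m - 1 = int j" by simp
  with 3 show ?thesis
    \<comment> \<open>With \<open>m = j + 1\<close> the factor \<open>X + Y + 2 - j\<close> becomes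
      \<open>m + \<alpha> + \<beta> + 1\<close>.\<close>
    using jacobi_form_sum_partials [of "real j + \<beta>" j "real j + \<alpha>" "w - 1" w]
    by (simp only: shifted_jacobi_eq_form) (simp add: add_ac)
qed (simp_all add: shifted_jacobi_neg)

lemma shifted_jacobi_has_derivative:
  "(shifted_jacobi m \<alpha> \<beta> has_real_derivative
    (m + \<alpha> + \<beta> + 1) * shifted_jacobi (m - 1) (\<alpha> + 1) (\<beta> + 1) w) (at w)"
proof (cases m rule: int_cases_Suc)
  case 1
  then have "shifted_jacobi m \<alpha> \<beta> = (\<lambda>w. 0)" by (auto simp: shifted_jacobi_neg)
  with 1 show ?thesis by (simp add: shifted_jacobi_neg)
next
  case 2
  then have "shifted_jacobi m \<alpha> \<beta> = (\<lambda>w. 1)" using shifted_jacobi_eq_form [of 0] by auto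
  with 2 show ?thesis by (simp add: shifted_jacobi_neg)
next
  case (3 j)
  then have j: "m - 1 = int j" by simp
  have "shifted_jacobi m \<alpha> \<beta> =
      (\<lambda>w. jacobi_form (Suc j) (real (Suc j) + \<alpha>) (real (Suc j) + \<beta>) (w - 1) w)"
    unfolding 3 by (rule ext) (rule shifted_jacobi_eq_form)
  then show ?thesis
    using jacobi_form_has_derivative [of j "real (Suc j) + \<alpha>" "real (Suc j) + \<beta>" w]
    \<comment> \<open>Splitting the single multiple back into two partial derivatives gives the
      shape of the form's derivative.\<close>
    unfolding shifted_jacobi_sum_partials [symmetric] unfolding j shifted_jacobi_eq_form
    by (simp add: 3 add_ac)
qed

section \<open>The twelve one-variable ladder relations\<close>

text \<open>\<open>V\<close> and \<open>W\<close> are the two partial derivatives of the form.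
  Solving \<open>p' = V + W\<close> and \<open>m * p = (w - 1) * V + w * W\<close> for them gives
  two relations; Pascal's rules and Euler's identity one degree higher give the others.\<close>

lemma shifted_jacobi_ladder:
  fixes m :: int and \<alpha> \<beta> w p p' :: real
  defines "p \<equiv> shifted_jacobi m \<alpha> \<beta> w" and "p' \<equiv> deriv (shifted_jacobi m \<alpha> \<beta>) w"
  shows jacobi_raise_both: "p' = (m + \<alpha> + \<beta> + 1) * shifted_jacobi (m - 1) (\<alpha> + 1) (\<beta> + 1) w"
    and jacobi_lower_both: "(w * \<alpha> - (1 - w) * \<beta>) * p - w * (1 - w) * p' =
      (m + 1) * shifted_jacobi (m + 1) (\<alpha> - 1) (\<beta> - 1) w"
    and jacobi_raise_left: "(m + \<alpha> + \<beta> + 1) * p + w * p' = (m + \<alpha> + \<beta> + 1) * shifted_jacobi m (\<alpha> + 1) \<beta> w"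
    and jacobi_lower_left: "(\<alpha> + m - w * m) * p - w * (1 - w) * p' = (m + \<alpha>) * shifted_jacobi m (\<alpha> - 1) \<beta> w"
    and jacobi_raise_right:
      "(m + \<alpha> + \<beta> + 1) * p - (1 - w) * p' = (m + \<alpha> + \<beta> + 1) * shifted_jacobi m \<alpha> (\<beta> + 1) w"
    and jacobi_lower_right: "(\<beta> + m * w) * p + w * (1 - w) * p' = (m + \<beta>) * shifted_jacobi m \<alpha> (\<beta> - 1) w"
    and jacobi_lower_left_Suc: "(w * \<alpha> - (1 - w) * (\<beta> + m + 1)) * p - w * (1 - w) * p' =
      (m + 1) * shifted_jacobi (m + 1) (\<alpha> - 1) \<beta> w"
    and jacobi_raise_left_pred: "w * p' - m * p = (m + \<beta>) * shifted_jacobi (m - 1) (\<alpha> + 1) \<beta> w"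
    and jacobi_lower_right_Suc: "(w * (\<alpha> + m + 1) - (1 - w) * \<beta>) * p - w * (1 - w) * p' =
      (m + 1) * shifted_jacobi (m + 1) \<alpha> (\<beta> - 1) w"
    and jacobi_raise_right_pred: "m * p + (1 - w) * p' = (m + \<alpha>) * shifted_jacobi (m - 1) \<alpha> (\<beta> + 1) w"
    and jacobi_lower_left_raise_right: "\<alpha> * p - (1 - w) * p' = (m + \<alpha>) * shifted_jacobi m (\<alpha> - 1) (\<beta> + 1) w"
    and jacobi_raise_left_lower_right: "\<beta> * p + w * p' = (m + \<beta>) * shifted_jacobi m (\<alpha> + 1) (\<beta> - 1) w"
proof -
  define V where "V = (m + \<beta>) * shifted_jacobi (m - 1) (\<alpha> + 1) \<beta> w"
  define W where "W = (m + \<alpha>) * shifted_jacobi (m - 1) \<alpha> (\<beta> + 1) w"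
  note pascal_left = shifted_jacobi_pascal_left [of m "\<alpha> - 1" _ w, simplified]
  note pascal_right = shifted_jacobi_pascal_right [of m _ "\<beta> - 1" w, simplified]
  show p': "p' = (m + \<alpha> + \<beta> + 1) * shifted_jacobi (m - 1) (\<alpha> + 1) (\<beta> + 1) w"
    unfolding p'_def by (rule DERIV_imp_deriv [OF shifted_jacobi_has_derivative])
  have VW: "p' = V + W"
    unfolding p' V_def W_def by (rule shifted_jacobi_sum_partials [symmetric])
  have euler: "m * p = (w - 1) * V + w * W"
    unfolding p_def V_def W_def by (rule shifted_jacobi_euler)
  show "(m + \<alpha> + \<beta> + 1) * p + w * p' = (m + \<alpha> + \<beta> + 1) * shifted_jacobi m (\<alpha> + 1) \<beta> w"
    unfolding p' p_def shifted_jacobi_pascal_left [of m \<alpha> \<beta> w] by algebra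
  show "(m + \<alpha> + \<beta> + 1) * p - (1 - w) * p' = (m + \<alpha> + \<beta> + 1) * shifted_jacobi m \<alpha> (\<beta> + 1) w"
    unfolding p' p_def shifted_jacobi_pascal_right [of m \<alpha> \<beta> w] by algebra
  have "w * p' - m * p = V"
    using VW euler by algebra
  then show "w * p' - m * p = (m + \<beta>) * shifted_jacobi (m - 1) (\<alpha> + 1) \<beta> w"
    unfolding V_def .
  have "m * p + (1 - w) * p' = W"
    using VW euler by algebra
  then show "m * p + (1 - w) * p' = (m + \<alpha>) * shifted_jacobi (m - 1) \<alpha> (\<beta> + 1) w"
    unfolding W_def .
  \<comment> \<open>Multiply Pascal's rule at \<open>\<alpha> - 1\<close> by
    \<open>m + \<alpha>\<close>: the correction is \<open>w * W\<close>, and Euler's identity turns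
    \<open>m * p - w * W\<close> into \<open>(w - 1) * V\<close>.\<close>
  have left: "(m + \<alpha>) * shifted_jacobi m (\<alpha> - 1) \<beta> w = \<alpha> * p + (w - 1) * V"
    using pascal_left [of \<beta>] euler unfolding p_def W_def by algebra
  have right: "(m + \<beta>) * shifted_jacobi m \<alpha> (\<beta> - 1) w = \<beta> * p + w * W"
    using pascal_right [of \<alpha>] euler unfolding p_def V_def by algebra
  show "(\<alpha> + m - w * m) * p - w * (1 - w) * p' = (m + \<alpha>) * shifted_jacobi m (\<alpha> - 1) \<beta> w"
    using left VW euler by algebra
  show "(\<beta> + m * w) * p + w * (1 - w) * p' = (m + \<beta>) * shifted_jacobi m \<alpha> (\<beta> - 1) w"
    using right VW euler by algebra
  show "\<alpha> * p - (1 - w) * p' = (m + \<alpha>) * shifted_jacobi m (\<alpha> - 1) (\<beta> + 1) w"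
    using shifted_jacobi_pascal_right [of m "\<alpha> - 1" \<beta> w] left VW unfolding W_def by simp algebra
  show "\<beta> * p + w * p' = (m + \<beta>) * shifted_jacobi m (\<alpha> + 1) (\<beta> - 1) w"
    using shifted_jacobi_pascal_left [of m \<alpha> "\<beta> - 1" w] right VW unfolding V_def by simp algebra
  \<comment> \<open>Euler's identity at degree \<open>m + 1\<close> with both parameters lowered:
    its two partial derivatives are exactly the polynomials in \<open>right\<close> and
    \<open>left\<close>.\<close>
  have "(m + 1) * shifted_jacobi (m + 1) (\<alpha> - 1) (\<beta> - 1) w =
      (w - 1) * ((m + \<beta>) * shifted_jacobi m \<alpha> (\<beta> - 1) w)
      + w * ((m + \<alpha>) * shifted_jacobi m (\<alpha> - 1) \<beta> w)"
    using shifted_jacobi_euler [of "m + 1" "\<alpha> - 1" "\<beta> - 1" w] by simp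
  then show both: "(w * \<alpha> - (1 - w) * \<beta>) * p - w * (1 - w) * p' =
      (m + 1) * shifted_jacobi (m + 1) (\<alpha> - 1) (\<beta> - 1) w"
    using left right VW by algebra
  \<comment> \<open>Raising one parameter back by Pascal's rule adds a multiple of \<open>p\<close>
    itself, since degree and parameters return to \<open>m\<close>, \<open>\<alpha>\<close>,
    \<open>\<beta>\<close>.\<close>
  show "(w * \<alpha> - (1 - w) * (\<beta> + m + 1)) * p - w * (1 - w) * p' =
      (m + 1) * shifted_jacobi (m + 1) (\<alpha> - 1) \<beta> w"
    using both shifted_jacobi_pascal_right [of "m + 1" "\<alpha> - 1" "\<beta> - 1" w] unfolding p_def by simp algebra
  show "(w * (\<alpha> + m + 1) - (1 - w) * \<beta>) * p - w * (1 - w) * p' =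
      (m + 1) * shifted_jacobi (m + 1) \<alpha> (\<beta> - 1) w"
    using both shifted_jacobi_pascal_left [of "m + 1" "\<alpha> - 1" "\<beta> - 1" w] unfolding p_def by simp algebra
qed

section \<open>The two-variable polynomials\<close>

text \<open>
  Outside the range \<^term>\<open>0 \<le> k \<and> k \<le> n\<close> one of the two shifted Jacobi factors vanishes,
  so with integer powers the product formula needs no case distinction.
\<close>

lemma jacobi2_eq:
  assumes "n - k = m" and "2 * real_of_int k + b + c + d + 1 = A"
  shows "jacobi2 n k a b c d x y =
    shifted_jacobi m A a x * (1 - x) powi k * shifted_jacobi k c b (y / (1 - x))"
  using assms by (auto simp: jacobi2_def shifted_jacobi_neg power_int_def)

theorem theorem1:
  fixes n k :: int and a b c d t x y :: real
  assumes "0 \<le> k" and "k \<le> n"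
    and "t = a + b + c + d"
    and "x \<noteq> 1"
  shows
    "M01 n k a b c d (jacobi2 n k a b c d) x y =
        (k + b + c + 1) * jacobi2 (n - 1) (k - 1) a (b + 1) (c + 1) d x y \<and>
     M01_dag n k a b c d (jacobi2 n k a b c d) x y =
        (k + 1) * jacobi2 (n + 1) (k + 1) a (b - 1) (c - 1) d x y \<and>
     M02 n k a b c d (jacobi2 n k a b c d) x y =
        (k + b + c + 1) * jacobi2 n k a b (c + 1) (d - 1) x y \<and>
     M02_dag n k a b c d (jacobi2 n k a b c d) x y =
        (k + c) * jacobi2 n k a b (c - 1) (d + 1) x y \<and>
     M03 n k a b c d (jacobi2 n k a b c d) x y =
        (k + b + c + 1) * jacobi2 n k a (b + 1) c (d - 1) x y \<and>
     M03_dag n k a b c d (jacobi2 n k a b c d) x y =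
        (k + b) * jacobi2 n k a (b - 1) c (d + 1) x y \<and>
     M04 n k a b c d (jacobi2 n k a b c d) x y =
        (k + 1) * jacobi2 (n + 1) (k + 1) a b (c - 1) (d - 1) x y \<and>
     M04_dag n k a b c d (jacobi2 n k a b c d) x y =
        (k + b) * jacobi2 (n - 1) (k - 1) a b (c + 1) (d + 1) x y \<and>
     M05 n k a b c d (jacobi2 n k a b c d) x y =
        (k + 1) * jacobi2 (n + 1) (k + 1) a (b - 1) c (d - 1) x y \<and>
     M05_dag n k a b c d (jacobi2 n k a b c d) x y =
        (k + c) * jacobi2 (n - 1) (k - 1) a (b + 1) c (d + 1) x y \<and>
     M06 n k a b c d (jacobi2 n k a b c d) x y =
        (k + c) * jacobi2 n k a (b + 1) (c - 1) d x y \<and>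
     M06_dag n k a b c d (jacobi2 n k a b c d) x y =
        (k + b) * jacobi2 n k a (b - 1) (c + 1) d x y \<and>
     M10 n k a b c d (jacobi2 n k a b c d) x y =
        (n + k + t + 2) * jacobi2 (n - 1) k (a + 1) b c (d + 1) x y \<and>
     M10_dag n k a b c d (jacobi2 n k a b c d) x y =
        (n - k + 1) * jacobi2 (n + 1) k (a - 1) b c (d - 1) x y \<and>
     M20 n k a b c d (jacobi2 n k a b c d) x y =
        (n + k + t + 2) * jacobi2 n k a b c (d + 1) x y \<and>
     M20_dag n k a b c d (jacobi2 n k a b c d) x y =
        (n + k + t - a + 1) * jacobi2 n k a b c (d - 1) x y \<and>
     M30 n k a b c d (jacobi2 n k a b c d) x y =
        (n + k + t + 2) * jacobi2 n k (a + 1) b c d x y \<and>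
     M30_dag n k a b c d (jacobi2 n k a b c d) x y =
        (n - k + a) * jacobi2 n k (a - 1) b c d x y \<and>
     M40 n k a b c d (jacobi2 n k a b c d) x y =
        (n - k + 1) * jacobi2 (n + 1) k a b c (d - 1) x y \<and>
     M40_dag n k a b c d (jacobi2 n k a b c d) x y =
        (n - k + a) * jacobi2 (n - 1) k a b c (d + 1) x y \<and>
     M50 n k a b c d (jacobi2 n k a b c d) x y =
        (n + k + t - a + 1) * jacobi2 (n - 1) k (a + 1) b c d x y \<and>
     M50_dag n k a b c d (jacobi2 n k a b c d) x y =
        (n - k + 1) * jacobi2 (n + 1) k (a - 1) b c d x y \<and>
     M60 n k a b c d (jacobi2 n k a b c d) x y =
        (n - k + a) * jacobi2 n k (a - 1) b c (d + 1) x y \<and>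
     M60_dag n k a b c d (jacobi2 n k a b c d) x y =
        (n + k + t - a + 1) * jacobi2 n k (a + 1) b c (d - 1) x y"
proof -
  define m A where "m = n - k" and "A = 2 * real_of_int k + b + c + d + 1"
  define r w E where "r = 1 - x" and "w = y / (1 - x)" and "E = r powi k"
  define F F' where "F = shifted_jacobi m A a x" and "F' = deriv (shifted_jacobi m A a) x"
  define G G' where "G = shifted_jacobi k c b w" and "G' = deriv (shifted_jacobi k c b) w"
  have r: "r \<noteq> 0" "1 - x = r" and x: "x = 1 - r" and t: "t = a + b + c + d"
    using assms by (auto simp: r_def)
  have y: "y = w * r" and w: "y / r = w"
    using r by (simp_all add: w_def)
  have powi: "r powi (k + 1) = E * r" "r powi (k - 1) = E / r"
    using r by (simp_all add: E_def power_int_add power_int_diff)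
  have u: "jacobi2 n k a b c d =
      (\<lambda>x y. shifted_jacobi m A a x * (1 - x) powi k * shifted_jacobi k c b (y / (1 - x)))"
    by (intro ext jacobi2_eq) (simp_all add: m_def A_def)
  have dF: "(shifted_jacobi m A a has_real_derivative F') (at x)"
    and dG: "(shifted_jacobi k c b has_real_derivative G') (at (y / (1 - x)))"
    unfolding F'_def G'_def w_def
    by (simp_all only: DERIV_imp_deriv [OF shifted_jacobi_has_derivative] shifted_jacobi_has_derivative)
  have dE: "((\<lambda>s. (1 - s) powi k) has_real_derivative - (k * E / r)) (at x)"
    using r powi by (auto intro!: derivative_eq_intros)
  have dGx: "((\<lambda>s. shifted_jacobi k c b (y / (1 - s))) has_real_derivative G' * (w / r)) (at x)"
    by (rule DERIV_chain2 [where g = "\<lambda>s. y / (1 - s)", OF dG])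
       (use r y in \<open>auto intro!: derivative_eq_intros simp: power2_eq_square\<close>)
  have dGy: "((\<lambda>s. shifted_jacobi k c b (s / (1 - x))) has_real_derivative G' * (1 / r)) (at y)"
    by (rule DERIV_chain2 [where g = "\<lambda>s. s / (1 - x)", OF dG])
       (use r in \<open>auto intro!: derivative_eq_intros\<close>)
  have P: "jacobi2 n k a b c d x y = F * E * G"
    by (simp add: u F_def E_def G_def w_def r_def)
  have uy: "pdy (jacobi2 n k a b c d) x y = F * E * G' / r"
    using DERIV_imp_deriv [OF DERIV_cmult [OF dGy, of "F * E"]]
    by (simp add: pdy_def u F_def E_def r(2))
  \<comment> \<open>The last two terms give
    \<open>ux - w * uy = F' * E * G - k * F * E * G / r\<close>: Euler's identity for the
    homogeneous factor removes \<open>G'\<close> from the second set.\<close>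
  have ux: "pdx (jacobi2 n k a b c d) x y = F' * E * G - k * F * E * G / r + w * F * E * G' / r"
    using DERIV_imp_deriv [OF DERIV_mult [OF DERIV_mult [OF dF dE] dGx]]
    by (simp add: pdx_def u F_def [symmetric] E_def [symmetric] r(2) w G_def [symmetric]
        algebra_simps)
  \<comment> \<open>The first set preserves \<open>n - k\<close> and
    \<open>2 * k + b + c + d\<close>, hence the factor \<open>F\<close>.\<close>
  have J1: "jacobi2 n' k' a b' c' d' x y = F * r powi k' * shifted_jacobi k' c' b' w"
    if "n' - k' = n - k" and "2 * real_of_int k' + b' + c' + d' = 2 * k + b + c + d"
    for n' k' b' c' d'
    using jacobi2_eq [of n' k' m b' c' d' A a x y] that
    unfolding F_def r_def w_def m_def A_def by simp
  \<comment> \<open>The second set fixes \<open>k\<close>, \<open>b\<close>, \<open>c\<close>, hence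
    \<open>E\<close> and \<open>G\<close>; a shift of \<open>d\<close> acts as a shift of
    \<open>A\<close>.\<close>
  have J2: "jacobi2 n' k a' b c d' x y = shifted_jacobi m' A' a' x * E * G"
    if "n' - n = m' - m" and "d' - d = A' - A" for n' m' d' A' a'
    using jacobi2_eq [of n' k m' b c d' A' a' x y] that
    unfolding E_def G_def r_def w_def m_def A_def by simp
  \<comment> \<open>The relation \<open>r * i = 1\<close> replaces division by \<open>1 - x\<close>,
    leaving polynomial identities for \<open>algebra\<close>.\<close>
  define i where "i = inverse r"
  have i: "r * i = 1"
    using r by (simp add: i_def)
  \<comment> \<open>These give the constants of the second set:
    \<open>m + A + a + 1 = n + k + t + 2\<close> and
    \<open>m + A = n + k + t - a + 1\<close>.\<close>
  have mA: "real_of_int m = real_of_int n - real_of_int k" "A = 2 * real_of_int k + b + c + d + 1"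
    by (simp_all add: m_def A_def)
  note set1 = powi of_int_add of_int_diff of_int_1 divide_inverse
  note set2 = of_int_add of_int_diff of_int_1 divide_inverse
  \<comment> \<open>Since \<open>y = w * r\<close> and \<open>1 - x - y = r * (1 - w)\<close>, each
    identity of the first set is a ladder relation for \<open>G\<close> times \<open>F\<close> and
    the power of \<open>r\<close> belonging to the target's second index.\<close>
  have M01: "M01 n k a b c d (jacobi2 n k a b c d) x y =
      (k + b + c + 1) * jacobi2 (n - 1) (k - 1) a (b + 1) (c + 1) d x y"
    using jacobi_raise_both [where m = k and \<alpha> = c and \<beta> = b and w = w, folded G_def G'_def] i
    unfolding M01_def P uy
    unfolding J1 [of "n - 1" "k - 1" "b + 1" "c + 1" d, simplified] set1 E_def [symmetric]
    unfolding r(2) y i_def [symmetric] by algebra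
  have M01_dag: "M01_dag n k a b c d (jacobi2 n k a b c d) x y =
      (k + 1) * jacobi2 (n + 1) (k + 1) a (b - 1) (c - 1) d x y"
    using jacobi_lower_both [where m = k and \<alpha> = c and \<beta> = b and w = w, folded G_def G'_def] i
    unfolding M01_dag_def P uy
    unfolding J1 [of "n + 1" "k + 1" "b - 1" "c - 1" d, simplified] set1 E_def [symmetric]
    unfolding r(2) y i_def [symmetric] by algebra
  have M02: "M02 n k a b c d (jacobi2 n k a b c d) x y =
      (k + b + c + 1) * jacobi2 n k a b (c + 1) (d - 1) x y"
    using jacobi_raise_left [where m = k and \<alpha> = c and \<beta> = b and w = w, folded G_def G'_def] i
    unfolding M02_def P uy
    unfolding J1 [of n k b "c + 1" "d - 1", simplified] set1 E_def [symmetric]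
    unfolding r(2) y i_def [symmetric] by algebra
  have M02_dag: "M02_dag n k a b c d (jacobi2 n k a b c d) x y =
      (k + c) * jacobi2 n k a b (c - 1) (d + 1) x y"
    using jacobi_lower_left [where m = k and \<alpha> = c and \<beta> = b and w = w, folded G_def G'_def] i
    unfolding M02_dag_def P uy
    unfolding J1 [of n k b "c - 1" "d + 1", simplified] set1 E_def [symmetric]
    unfolding r(2) y i_def [symmetric] by algebra
  have M03: "M03 n k a b c d (jacobi2 n k a b c d) x y =
      (k + b + c + 1) * jacobi2 n k a (b + 1) c (d - 1) x y"
    using jacobi_raise_right [where m = k and \<alpha> = c and \<beta> = b and w = w, folded G_def G'_def] i
    unfolding M03_def P uy
    unfolding J1 [of n k "b + 1" c "d - 1", simplified] set1 E_def [symmetric]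
    unfolding r(2) y i_def [symmetric] by algebra
  have M03_dag: "M03_dag n k a b c d (jacobi2 n k a b c d) x y =
      (k + b) * jacobi2 n k a (b - 1) c (d + 1) x y"
    using jacobi_lower_right [where m = k and \<alpha> = c and \<beta> = b and w = w, folded G_def G'_def] i
    unfolding M03_dag_def P uy
    unfolding J1 [of n k "b - 1" c "d + 1", simplified] set1 E_def [symmetric]
    unfolding r(2) y i_def [symmetric] by algebra
  have M04: "M04 n k a b c d (jacobi2 n k a b c d) x y =
      (k + 1) * jacobi2 (n + 1) (k + 1) a b (c - 1) (d - 1) x y"
    using jacobi_lower_left_Suc [where m = k and \<alpha> = c and \<beta> = b and w = w, folded G_def G'_def] i
    unfolding M04_def P uy
    unfolding J1 [of "n + 1" "k + 1" b "c - 1" "d - 1", simplified] set1 E_def [symmetric]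
    unfolding r(2) y i_def [symmetric] by algebra
  have M04_dag: "M04_dag n k a b c d (jacobi2 n k a b c d) x y =
      (k + b) * jacobi2 (n - 1) (k - 1) a b (c + 1) (d + 1) x y"
    using jacobi_raise_left_pred [where m = k and \<alpha> = c and \<beta> = b and w = w, folded G_def G'_def] i
    unfolding M04_dag_def P uy
    unfolding J1 [of "n - 1" "k - 1" b "c + 1" "d + 1", simplified] set1 E_def [symmetric]
    unfolding r(2) y i_def [symmetric] by algebra
  have M05: "M05 n k a b c d (jacobi2 n k a b c d) x y =
      (k + 1) * jacobi2 (n + 1) (k + 1) a (b - 1) c (d - 1) x y"
    using jacobi_lower_right_Suc [where m = k and \<alpha> = c and \<beta> = b and w = w, folded G_def G'_def] i
    unfolding M05_def P uy
    unfolding J1 [of "n + 1" "k + 1" "b - 1" c "d - 1", simplified] set1 E_def [symmetric]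
    unfolding r(2) y i_def [symmetric] by algebra
  have M05_dag: "M05_dag n k a b c d (jacobi2 n k a b c d) x y =
      (k + c) * jacobi2 (n - 1) (k - 1) a (b + 1) c (d + 1) x y"
    using jacobi_raise_right_pred [where m = k and \<alpha> = c and \<beta> = b and w = w, folded G_def G'_def] i
    unfolding M05_dag_def P uy
    unfolding J1 [of "n - 1" "k - 1" "b + 1" c "d + 1", simplified] set1 E_def [symmetric]
    unfolding r(2) y i_def [symmetric] by algebra
  have M06: "M06 n k a b c d (jacobi2 n k a b c d) x y =
      (k + c) * jacobi2 n k a (b + 1) (c - 1) d x y"
    using jacobi_lower_left_raise_right [where m = k and \<alpha> = c and \<beta> = b and w = w, folded G_def G'_def] i
    unfolding M06_def P uy
    unfolding J1 [of n k "b + 1" "c - 1" d, simplified] set1 E_def [symmetric]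
    unfolding r(2) y i_def [symmetric] by algebra
  have M06_dag: "M06_dag n k a b c d (jacobi2 n k a b c d) x y =
      (k + b) * jacobi2 n k a (b - 1) (c + 1) d x y"
    using jacobi_raise_left_lower_right [where m = k and \<alpha> = c and \<beta> = b and w = w, folded G_def G'_def] i
    unfolding M06_dag_def P uy
    unfolding J1 [of n k "b - 1" "c + 1" d, simplified] set1 E_def [symmetric]
    unfolding r(2) y i_def [symmetric] by algebra
  \<comment> \<open>Each identity of the second set is a ladder relation for \<open>F\<close> at
    \<open>x\<close>, with parameters \<open>A\<close> and \<open>a\<close>, times
    \<open>E * G\<close>.\<close>
  have M10: "M10 n k a b c d (jacobi2 n k a b c d) x y =
      (n + k + t + 2) * jacobi2 (n - 1) k (a + 1) b c (d + 1) x y"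
    using jacobi_raise_both [where m = m and \<alpha> = A and \<beta> = a and w = x, folded F_def F'_def] i x
    unfolding M10_def P ux uy
    unfolding J2 [of "n - 1" "m - 1" "d + 1" "A + 1", simplified] set2 mA t
    unfolding r(2) y i_def [symmetric] by algebra
  have M10_dag: "M10_dag n k a b c d (jacobi2 n k a b c d) x y =
      (n - k + 1) * jacobi2 (n + 1) k (a - 1) b c (d - 1) x y"
    using jacobi_lower_both [where m = m and \<alpha> = A and \<beta> = a and w = x, folded F_def F'_def] i x
    unfolding M10_dag_def P ux uy
    unfolding J2 [of "n + 1" "m + 1" "d - 1" "A - 1", simplified] set2 mA t
    unfolding r(2) y i_def [symmetric] by algebra
  have M20: "M20 n k a b c d (jacobi2 n k a b c d) x y =
      (n + k + t + 2) * jacobi2 n k a b c (d + 1) x y"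
    using jacobi_raise_left [where m = m and \<alpha> = A and \<beta> = a and w = x, folded F_def F'_def] i x
    unfolding M20_def P ux uy
    unfolding J2 [of n m "d + 1" "A + 1", simplified] set2 mA t
    unfolding r(2) y i_def [symmetric] by algebra
  have M20_dag: "M20_dag n k a b c d (jacobi2 n k a b c d) x y =
      (n + k + t - a + 1) * jacobi2 n k a b c (d - 1) x y"
    using jacobi_lower_left [where m = m and \<alpha> = A and \<beta> = a and w = x, folded F_def F'_def] i x
    unfolding M20_dag_def P ux uy
    unfolding J2 [of n m "d - 1" "A - 1", simplified] set2 mA t
    unfolding r(2) y i_def [symmetric] by algebra
  have M30: "M30 n k a b c d (jacobi2 n k a b c d) x y =
      (n + k + t + 2) * jacobi2 n k (a + 1) b c d x y"
    using jacobi_raise_right [where m = m and \<alpha> = A and \<beta> = a and w = x, folded F_def F'_def] i x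
    unfolding M30_def P ux uy
    unfolding J2 [of n m d A, simplified] set2 mA t
    unfolding r(2) y i_def [symmetric] by algebra
  have M30_dag: "M30_dag n k a b c d (jacobi2 n k a b c d) x y =
      (n - k + a) * jacobi2 n k (a - 1) b c d x y"
    using jacobi_lower_right [where m = m and \<alpha> = A and \<beta> = a and w = x, folded F_def F'_def] i x
    unfolding M30_dag_def P ux uy
    unfolding J2 [of n m d A, simplified] set2 mA t
    unfolding r(2) y i_def [symmetric] by algebra
  have M40: "M40 n k a b c d (jacobi2 n k a b c d) x y =
      (n - k + 1) * jacobi2 (n + 1) k a b c (d - 1) x y"
    using jacobi_lower_left_Suc [where m = m and \<alpha> = A and \<beta> = a and w = x, folded F_def F'_def] i x
    unfolding M40_def P ux uy
    unfolding J2 [of "n + 1" "m + 1" "d - 1" "A - 1", simplified] set2 mA t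
    unfolding r(2) y i_def [symmetric] by algebra
  have M40_dag: "M40_dag n k a b c d (jacobi2 n k a b c d) x y =
      (n - k + a) * jacobi2 (n - 1) k a b c (d + 1) x y"
    using jacobi_raise_left_pred [where m = m and \<alpha> = A and \<beta> = a and w = x, folded F_def F'_def] i x
    unfolding M40_dag_def P ux uy
    unfolding J2 [of "n - 1" "m - 1" "d + 1" "A + 1", simplified] set2 mA t
    unfolding r(2) y i_def [symmetric] by algebra
  \<comment> \<open>In the pairs 5 and 6 the relations for an operator and its dagger are
    interchanged compared with the first set.\<close>
  have M50: "M50 n k a b c d (jacobi2 n k a b c d) x y =
      (n + k + t - a + 1) * jacobi2 (n - 1) k (a + 1) b c d x y"
    using jacobi_raise_right_pred [where m = m and \<alpha> = A and \<beta> = a and w = x, folded F_def F'_def] i x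
    unfolding M50_def P ux uy
    unfolding J2 [of "n - 1" "m - 1" d A, simplified] set2 mA t
    unfolding r(2) y i_def [symmetric] by algebra
  have M50_dag: "M50_dag n k a b c d (jacobi2 n k a b c d) x y =
      (n - k + 1) * jacobi2 (n + 1) k (a - 1) b c d x y"
    using jacobi_lower_right_Suc [where m = m and \<alpha> = A and \<beta> = a and w = x, folded F_def F'_def] i x
    unfolding M50_dag_def P ux uy
    unfolding J2 [of "n + 1" "m + 1" d A, simplified] set2 mA t
    unfolding r(2) y i_def [symmetric] by algebra
  have M60: "M60 n k a b c d (jacobi2 n k a b c d) x y =
      (n - k + a) * jacobi2 n k (a - 1) b c (d + 1) x y"
    using jacobi_raise_left_lower_right [where m = m and \<alpha> = A and \<beta> = a and w = x, folded F_def F'_def] i x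
    unfolding M60_def P ux uy
    unfolding J2 [of n m "d + 1" "A + 1", simplified] set2 mA t
    unfolding r(2) y i_def [symmetric] by algebra
  have M60_dag: "M60_dag n k a b c d (jacobi2 n k a b c d) x y =
      (n + k + t - a + 1) * jacobi2 n k (a + 1) b c (d - 1) x y"
    using jacobi_lower_left_raise_right [where m = m and \<alpha> = A and \<beta> = a and w = x, folded F_def F'_def] i x
    unfolding M60_dag_def P ux uy
    unfolding J2 [of n m "d - 1" "A - 1", simplified] set2 mA t
    unfolding r(2) y i_def [symmetric] by algebra
  show ?thesis
    by (intro conjI) (fact M01 M01_dag M02 M02_dag M03 M03_dag M04 M04_dag M05 M05_dag M06 M06_dag
        M10 M10_dag M20 M20_dag M30 M30_dag M40 M40_dag M50 M50_dag M60 M60_dag)+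
qed

end
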